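(* Let $p\in[0,1]$. For each value of $d\in[0,d^{max}]$ and each maximum horizon $\ell\geq 1$ (a finite integer), there exists a unique equilibrium sequence $\{c_{t+k},\pi_{t+k}\}_{k\geq 0}$ that solves the Euler equation, the Phillips curve and the Taylor rule of the model described in the context, when the demand shock follows the truncated Markov chain with parameters $(p,d,\ell)$ and the economy is in its intended steady state ($c=\pi=0$) whenever the shock is in its absorbing state.
   Context: Parameters: $\sigma,\kappa,\eta,\psi,\mu>0$, $\beta\in(0,1)$, $\bar c\in(0,1)$, $m_{xx},m_{x\pi},m_{\pi\pi}\in(0,1]$, and $d^{max}>0$ is a fixed upper bound on the shock size. Model (no government spending): for each date $t$, $$c_t=m_{xx}\mathbb{E}_tc_{t+1}-\sigma\left(i_t-m_{x\pi}\mathbb{E}_t\pi_{t+1}+d_t\right)\quad\text{(Euler equation)},$$ $$\pi_t=m_{\pi\pi}\beta\,\mathbb{E}_t\pi_{t+1}+\kappa(1+\eta\bar c)c_t\quad\text{(Phillips curve)},$$ $$i_t=\max\{\psi\pi_t,-\mu\}\quad\text{(Taylor rule)}.$$ Truncated Markov chain: at date $t$ the shock starts in the low state, $d_t=d$. In periods $t,\dots,t+\ell-1$ it follows the Markov chain which, from the low state (value $d$), stays in the low state with probability $p$ and moves to the absorbing state (value $0$) with probability $1-p$; the absorbing state is never left. If the shock is still in the low state at date $t+\ell-1$, it jumps deterministically to the absorbing state at date $t+\ell$. Terminal condition (standing assumption): whenever the shock is in the absorbing state, the economy is in the intended steady state, $c=0$, $\pi=0$. Consequently an equilibrium sequence is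 described by the values $(\tilde c_{t+n}(\ell),\tilde\pi_{t+n}(\ell))$, $n=0,\dots,\ell-1$, of consumption and inflation conditional on the shock still being in the low state at $t+n$; conditional on the low state at $t+n$, expectations are $\mathbb{E}_{t+n}x_{t+n+1}=p\,\tilde x_{t+n+1}(\ell)+(1-p)\cdot 0$ for $n<\ell-1$ and $\mathbb{E}_{t+\ell-1}x_{t+\ell}=0$, for $x\in\{c,\pi\}$. *)

theory Defs
  imports "HOL-Probability.Probability_Mass_Function" "HOL-Library.FuncSet"
begin

datatype shock_state = Low | Absorbing

fun shock_value :: "real \<Rightarrow> shock_state \<Rightarrow> real" where
  "shock_value d Low = d"
| "shock_value d Absorbing = 0"

(* Dates k are counted from the initial date, at which the shock is Low.
   shock_kernel p l k s is the law of the state at date k + 1 given state s at date k;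
   l is the maximum horizon, so that l - 1 is the last date at which the shock can be Low. *)
fun shock_kernel :: "real \<Rightarrow> nat \<Rightarrow> nat \<Rightarrow> shock_state \<Rightarrow> shock_state pmf" where
  "shock_kernel p l k Low =
     (if Suc k < l
      then map_pmf (\<lambda>stay. if stay then Low else Absorbing) (bernoulli_pmf p)
      else return_pmf Absorbing)"
| "shock_kernel p l k Absorbing = return_pmf Absorbing"

(* Date-state pairs of the truncated chain, independently of p: for p = 0 or p = 1 nodes of
   probability zero are kept, since outcomes are specified conditionally on the state.
   Indexing outcomes by date and current state rather than by shock history loses nothing:
   there is a single history ending in Low at a given date, and in Absorbing all outcomes
   are fixed by the terminal condition. *)
definition shock_nodes :: "nat \<Rightarrow> (nat \<times> shock_state) set" where
  "shock_nodes l = {0..<l} \<times> {Low} \<union> {1..} \<times> {Absorbing}"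

definition cond_exp_next ::
    "real \<Rightarrow> nat \<Rightarrow> (nat \<times> shock_state \<Rightarrow> real) \<Rightarrow> nat \<times> shock_state \<Rightarrow> real" where
  "cond_exp_next p l x = (\<lambda>(k, s).
     measure_pmf.expectation (shock_kernel p l k s) (\<lambda>s'. x (Suc k, s')))"

definition taylor_rate :: "real \<Rightarrow> real \<Rightarrow> real \<Rightarrow> real" where
  "taylor_rate \<psi> \<mu> infl = max (\<psi> * infl) (- \<mu>)"

definition euler_eq ::
    "real \<Rightarrow> real \<Rightarrow> real \<Rightarrow> real \<Rightarrow> real \<Rightarrow> real \<Rightarrow> real \<Rightarrow> real \<Rightarrow> bool" where
  "euler_eq \<sigma> mxx mxpi c Ec i Epi shock \<longleftrightarrow>
     c = mxx * Ec - \<sigma> * (i - mxpi * Epi + shock)"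

definition phillips_eq ::
    "real \<Rightarrow> real \<Rightarrow> real \<Rightarrow> real \<Rightarrow> real \<Rightarrow> real \<Rightarrow> real \<Rightarrow> real \<Rightarrow> bool" where
  "phillips_eq \<kappa> \<eta> cbar \<beta> mpipi infl Epi c \<longleftrightarrow>
     infl = mpipi * \<beta> * Epi + \<kappa> * (1 + \<eta> * cbar) * c"

(* The extensional conditions only fix the irrelevant values outside shock_nodes, so that
   equality of plans is equality on the nodes. *)
definition is_equilibrium ::
    "real \<Rightarrow> real \<Rightarrow> real \<Rightarrow> real \<Rightarrow> real \<Rightarrow> real \<Rightarrow> real \<Rightarrow> real \<Rightarrow> real \<Rightarrow> real
     \<Rightarrow> real \<Rightarrow> real \<Rightarrow> nat
     \<Rightarrow> (nat \<times> shock_state \<Rightarrow> real) \<Rightarrow> (nat \<times> shock_state \<Rightarrow> real) \<Rightarrow> bool" where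
  "is_equilibrium \<sigma> \<kappa> \<eta> \<psi> \<mu> \<beta> cbar mxx mxpi mpipi p d l c \<pi> \<longleftrightarrow>
     c \<in> extensional (shock_nodes l) \<and> \<pi> \<in> extensional (shock_nodes l) \<and>
     (\<forall>(k, s) \<in> shock_nodes l.
        euler_eq \<sigma> mxx mxpi (c (k, s)) (cond_exp_next p l c (k, s))
          (taylor_rate \<psi> \<mu> (\<pi> (k, s))) (cond_exp_next p l \<pi> (k, s)) (shock_value d s) \<and>
        phillips_eq \<kappa> \<eta> cbar \<beta> mpipi (\<pi> (k, s)) (cond_exp_next p l \<pi> (k, s)) (c (k, s)) \<and>
        (s = Absorbing \<longrightarrow> c (k, s) = 0 \<and> \<pi> (k, s) = 0))"

end

theory Submission
  imports Defs
begin

text \<open>Substituting the Phillips curve into the Euler equation leaves, for given expectations, one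
  equation for current inflation whose left-hand side is strictly increasing and piecewise linear.
  Each period thus has exactly one solution for given expectations, and since the outcome is zero
  from date \<open>l\<close> on, backward induction determines the whole equilibrium.\<close>

text \<open>The left-hand side is the maximum of two increasing affine functions of
  \<open>y\<close>, one for each branch of the Taylor rule. Its inverse is therefore the minimum of
  their inverses.\<close>

lemma taylor_rate_equation_iff:
  assumes "g > 0" "\<psi> > 0"
  shows "y + g * taylor_rate \<psi> \<mu> y = z \<longleftrightarrow> y = min (z / (1 + g * \<psi>)) (z + g * \<mu>)"
proof -
  have pos: "1 + g * \<psi> > 0"
    using assms by (simp add: add_pos_pos)
  have "y + g * taylor_rate \<psi> \<mu> y = max (y + g * (\<psi> * y)) (y + g * (- \<mu>))"
    using assms by (simp add: taylor_rate_def max_mult_distrib_left max_add_distrib_right)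
  also have "\<dots> = max (y * (1 + g * \<psi>)) (y - g * \<mu>)"
    by (simp add: algebra_simps)
  finally have lhs: "y + g * taylor_rate \<psi> \<mu> y = max (y * (1 + g * \<psi>)) (y - g * \<mu>)" .
  have "y * (1 + g * \<psi>) \<le> z \<longleftrightarrow> y \<le> z / (1 + g * \<psi>)"
       "y * (1 + g * \<psi>) = z \<longleftrightarrow> y = z / (1 + g * \<psi>)"
    using pos by (auto simp: field_simps)
  then show ?thesis
    unfolding lhs by (auto simp: max_def min_def)
qed

text \<open>The equivalence carries existence and uniqueness at once: \<open>F\<close> maps expected
  consumption and inflation \<open>(a, b)\<close> to the current pair.\<close>

lemma stage_solution:
  assumes "\<sigma> > 0" "\<kappa> * (1 + \<eta> * cbar) > 0" "\<psi> > 0"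
  obtains F where "\<And>x a y b.
      euler_eq \<sigma> mxx mxpi x a (taylor_rate \<psi> \<mu> y) b d \<and> phillips_eq \<kappa> \<eta> cbar \<beta> mpipi y b x
      \<longleftrightarrow> (x, y) = F (a, b)"
proof -
  define K where "K = \<kappa> * (1 + \<eta> * cbar)"
  define g where "g = K * \<sigma>"
  have K: "K > 0" and g: "g > 0"
    using assms by (simp_all add: K_def g_def)
  \<comment> \<open>Multiplying the Euler equation by \<open>K\<close> and replacing
    \<open>K * x\<close> via the Phillips curve gives \<open>y + g * i = z a b\<close>, where
    \<open>i\<close> is the policy rate. \<open>Y\<close> is the solution for inflation, and
    \<open>F\<close> recovers consumption from it.\<close>
  define z where "z a b = mpipi * \<beta> * b + K * (mxx * a + \<sigma> * mxpi * b - \<sigma> * d)" for a b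
  define Y where "Y a b = min (z a b / (1 + g * \<psi>)) (z a b + g * \<mu>)" for a b
  define F where "F = (\<lambda>(a, b). ((Y a b - mpipi * \<beta> * b) / K, Y a b))"
  have "euler_eq \<sigma> mxx mxpi x a (taylor_rate \<psi> \<mu> y) b d \<and> phillips_eq \<kappa> \<eta> cbar \<beta> mpipi y b x
      \<longleftrightarrow> (x, y) = F (a, b)" for x a y b
  proof -
    let ?i = "taylor_rate \<psi> \<mu> y"
    have phillips: "phillips_eq \<kappa> \<eta> cbar \<beta> mpipi y b x \<longleftrightarrow> x = (y - mpipi * \<beta> * b) / K"
      using K by (auto simp: phillips_eq_def K_def[symmetric] field_simps)
    have "euler_eq \<sigma> mxx mxpi x a ?i b d \<longleftrightarrow> y = Y a b"
      if x: "x = (y - mpipi * \<beta> * b) / K"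
    proof -
      have "K * x = y - mpipi * \<beta> * b"
        using K x by simp
      moreover have "euler_eq \<sigma> mxx mxpi x a ?i b d \<longleftrightarrow>
          K * x = K * (mxx * a - \<sigma> * (?i - mxpi * b + d))"
        using K by (simp add: euler_eq_def)
      ultimately have "euler_eq \<sigma> mxx mxpi x a ?i b d \<longleftrightarrow> y + g * ?i = z a b"
        by (auto simp: z_def g_def algebra_simps)
      then show ?thesis
        using taylor_rate_equation_iff[OF g \<open>\<psi> > 0\<close>] by (simp add: Y_def)
    qed
    then show ?thesis
      unfolding phillips by (auto simp: F_def)
  qed
  then show thesis
    by (rule that)
qed

text \<open>\<open>a\<close> is the continuation value after the last date. Since
  \<open>l - k = Suc (l - Suc k)\<close>, each step back adds one application of \<open>G\<close>;
  at \<open>k = l - 1\<close> the inner iterate is \<open>a\<close> itself.\<close>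

lemma backward_recursion_iff:
  "(\<forall>k<l. w k = G (if Suc k < l then w (Suc k) else a)) \<longleftrightarrow> (\<forall>k<l. w k = (G ^^ (l - k)) a)"
proof
  assume rec: "\<forall>k<l. w k = G (if Suc k < l then w (Suc k) else a)"
  have "w k = (G ^^ (l - k)) a" if "k < l" for k
    using that
  proof (induction "l - k" arbitrary: k rule: less_induct)
    case less
    have "(G ^^ (l - k)) a = G ((G ^^ (l - Suc k)) a)"
      using less.prems by (simp add: Suc_diff_Suc[symmetric])
    then show ?case
      using rec less by (cases "Suc k < l") auto
  qed
  then show "\<forall>k<l. w k = (G ^^ (l - k)) a"
    by blast
next
  assume *: "\<forall>k<l. w k = (G ^^ (l - k)) a"
  show "\<forall>k<l. w k = G (if Suc k < l then w (Suc k) else a)"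
  proof (intro allI impI)
    fix k assume "k < l"
    moreover from this have "(G ^^ (l - k)) a = G ((G ^^ (l - Suc k)) a)"
      by (simp add: Suc_diff_Suc[symmetric])
    ultimately show "w k = G (if Suc k < l then w (Suc k) else a)"
      using * by auto
  qed
qed

lemma shock_nodes_iff [simp]:
  "(k, Low) \<in> shock_nodes l \<longleftrightarrow> k < l"
  "(k, Absorbing) \<in> shock_nodes l \<longleftrightarrow> 1 \<le> k"
  by (auto simp: shock_nodes_def)

lemma Ball_shock_nodes_iff:
  "(\<forall>(k, s) \<in> shock_nodes l. P k s) \<longleftrightarrow> (\<forall>k<l. P k Low) \<and> (\<forall>k\<ge>1. P k Absorbing)"
  by (auto simp: shock_nodes_def)

lemma cond_exp_next_Absorbing [simp]: "cond_exp_next p l x (k, Absorbing) = x (Suc k, Absorbing)"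
  by (simp add: cond_exp_next_def)

text \<open>The absorbing branch contributes zero, and at the last low date it is the only branch.
  The default \<open>0\<close> beyond the horizon lets both cases share the factor
  \<open>p\<close>.\<close>

lemma cond_exp_next_Low:
  assumes "p \<in> {0..1}" "x (Suc k, Absorbing) = 0"
  shows "cond_exp_next p l x (k, Low) = p * (if Suc k < l then x (Suc k, Low) else 0)"
  using assms by (simp add: cond_exp_next_def integral_bernoulli_pmf)

lemma eq_restrict_shock_nodes_iff:
  "x = restrict (\<lambda>(k, s). if s = Low then f k else 0) (shock_nodes l) \<longleftrightarrow>
     x \<in> extensional (shock_nodes l) \<and> (\<forall>k<l. x (k, Low) = f k) \<and> (\<forall>k\<ge>1. x (k, Absorbing) = 0)"
  (is "x = ?r \<longleftrightarrow> ?R")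
proof
  assume ?R
  show "x = ?r"
  proof (rule extensionalityI[where A = "shock_nodes l"])
    show "x n = ?r n" if "n \<in> shock_nodes l" for n
      using that \<open>?R\<close> by (cases n; cases "snd n") auto
  qed (use \<open>?R\<close> in auto)
qed auto

text \<open>Expectations in the low state are \<open>p\<close> times the next low pair, taken as a
  vector, so the stage equations form a backward recursion with map \<open>F (p *\<^sub>R z)\<close>
  started at \<open>0\<close>. Here \<open>u n\<close> is the low outcome with \<open>n\<close> low
  dates left, the current one included.\<close>

lemma is_equilibrium_iff:
  assumes "\<mu> > 0" "p \<in> {0..1}"
    and F: "\<And>x a y b.
      euler_eq \<sigma> mxx mxpi x a (taylor_rate \<psi> \<mu> y) b d \<and> phillips_eq \<kappa> \<eta> cbar \<beta> mpipi y b x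
      \<longleftrightarrow> (x, y) = F (a, b)"
  defines "u \<equiv> \<lambda>n. ((\<lambda>z. F (p *\<^sub>R z)) ^^ n) 0"
  shows "is_equilibrium \<sigma> \<kappa> \<eta> \<psi> \<mu> \<beta> cbar mxx mxpi mpipi p d l c \<pi> \<longleftrightarrow>
     c = restrict (\<lambda>(k, s). if s = Low then fst (u (l - k)) else 0) (shock_nodes l) \<and>
     \<pi> = restrict (\<lambda>(k, s). if s = Low then snd (u (l - k)) else 0) (shock_nodes l)"
\<comment> \<open>The formula for low-state expectations presupposes zero absorbing outcomes; where
  these fail, both sides are false.\<close>
proof (cases "\<forall>k\<ge>1. c (k, Absorbing) = 0 \<and> \<pi> (k, Absorbing) = 0")
  case True
  let ?w = "\<lambda>k. (c (k, Low), \<pi> (k, Low))"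
  have stage: "euler_eq \<sigma> mxx mxpi (c (k, Low)) (cond_exp_next p l c (k, Low))
         (taylor_rate \<psi> \<mu> (\<pi> (k, Low))) (cond_exp_next p l \<pi> (k, Low)) d \<and>
       phillips_eq \<kappa> \<eta> cbar \<beta> mpipi (\<pi> (k, Low)) (cond_exp_next p l \<pi> (k, Low)) (c (k, Low))
     \<longleftrightarrow> ?w k = F (p *\<^sub>R (if Suc k < l then ?w (Suc k) else 0))" for k
    using True \<open>p \<in> {0..1}\<close> unfolding F by (simp add: cond_exp_next_Low zero_prod_def)
  have "(\<forall>k<l. ?w k = F (p *\<^sub>R (if Suc k < l then ?w (Suc k) else 0))) \<longleftrightarrow>
      (\<forall>k<l. ?w k = u (l - k))"
    unfolding u_def by (rule backward_recursion_iff)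
  \<comment> \<open>At absorbing nodes the Euler equation reduces to this: the lower bound is slack
    in the intended steady state.\<close>
  moreover have "taylor_rate \<psi> \<mu> 0 = 0"
    using \<open>\<mu> > 0\<close> by (simp add: taylor_rate_def)
  ultimately show ?thesis
    using True unfolding is_equilibrium_def Ball_shock_nodes_iff eq_restrict_shock_nodes_iff
    \<comment> \<open>Instantiating current consumption and inflation by \<open>0\<close> unfolds
      the equations at absorbing nodes, while \<open>stage\<close> rewrites the low ones as a
      whole.\<close>
    by (auto simp: stage euler_eq_def[of _ _ _ 0] phillips_eq_def[of _ _ _ _ _ 0] prod_eq_iff)
next
  case False
  then show ?thesis
    unfolding is_equilibrium_def Ball_shock_nodes_iff eq_restrict_shock_nodes_iff by blast
qed

theorem proposition3:
  fixes \<sigma> \<kappa> \<eta> \<psi> \<mu> \<beta> cbar mxx mxpi mpipi dmax p d :: real and l :: nat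
  assumes "\<sigma> > 0" "\<kappa> > 0" "\<eta> > 0" "\<psi> > 0" "\<mu> > 0"
    and "\<beta> \<in> {0<..<1}" "cbar \<in> {0<..<1}"
    and "mxx \<in> {0<..1}" "mxpi \<in> {0<..1}" "mpipi \<in> {0<..1}"
    and "dmax > 0"
    and "p \<in> {0..1}"
    and "d \<in> {0..dmax}"
    and "l \<ge> 1"
  shows "\<exists>!(c, \<pi>). is_equilibrium \<sigma> \<kappa> \<eta> \<psi> \<mu> \<beta> cbar mxx mxpi mpipi p d l c \<pi>"
proof -
  have "\<kappa> * (1 + \<eta> * cbar) > 0"
    using assms by (simp add: add_pos_pos)
  then obtain F where F: "\<And>x a y b.
      euler_eq \<sigma> mxx mxpi x a (taylor_rate \<psi> \<mu> y) b d \<and> phillips_eq \<kappa> \<eta> cbar \<beta> mpipi y b x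
      \<longleftrightarrow> (x, y) = F (a, b)"
    using stage_solution[OF \<open>\<sigma> > 0\<close> _ \<open>\<psi> > 0\<close>] by blast
  \<comment> \<open>Being an equilibrium now means equality with two explicit functions, which
    settles existence and uniqueness together.\<close>
  show ?thesis
    unfolding is_equilibrium_iff[OF \<open>\<mu> > 0\<close> \<open>p \<in> {0..1}\<close> F] by auto
qed

end
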